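(* Assume $\mu>0$, $K>0$, $L>0$, and that $h$ satisfies the assumption stated in the context. There exist unique constants $A^*,B^*,d^*,D^*,U^*,u^*$ with $$d^*<x_1<D^*<U^*<x_2<u^*$$ such that the function $g(x)=g_{A^*,B^*}(x)$ satisfies $$\int_{d^*}^{D^*}[g(x)+k]\,dx=-K,\qquad \int_{U^*}^{u^*}[g(x)-\ell]\,dx=L,$$ $$g(d^* )=g(D^* )=-k,\qquad g(U^* )=g(u^* )=\ell,$$ where $x_1$ and $x_2$ are such that: $g$ has a local minimum at $x_1<a$ and a local maximum at $x_2>a$, and $g$ is decreasing on $(-\infty,x_1)$, increasing on $(x_1,x_2)$ and decreasing again on $(x_2,\infty)$.
   Context: $\mu>0$, $\sigma>0$, $K>0$, $L>0$, $k>0$, $\ell>0$ are constants and $\lambda=2\mu/\sigma^2>0$. Assumption on $h:\mathbb R\to[0,\infty)$: $h$ is continuous and convex; there is $a\in\mathbb R$ such that $h$ is $C^2$ on $\mathbb R\setminus\{a\}$ and $h(a)=0$; $h'(x)<0$ for $x<a$ and $h'(x)>0$ for $x>a$; and $\int_{-\infty}^a|h'(y)|e^{\lambda(y-a)}dy<\infty$. For $A,B\in\mathbb R$ and $x\in\mathbb R$, $$g_{A,B}(x)=A-Be^{-\lambda(x-a)}-\frac{\lambda}{\mu}\int_a^x h(y)e^{-\lambda(x-y)}\,dy.$$ *)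

theory Defs
  imports "HOL-Analysis.Analysis"
begin

definition C2_on :: "real set \<Rightarrow> (real \<Rightarrow> real) \<Rightarrow> bool" where
  "C2_on S f \<longleftrightarrow>
     f differentiable_on S \<and> deriv f differentiable_on S \<and> continuous_on S (deriv (deriv f))"

text \<open>
  The integrability condition is stated on the open half-line, because \<open>h\<close> need not be
  differentiable at \<open>a\<close>. The integrand is nonnegative, so integrability is finiteness of the integral.
\<close>

definition holding_cost :: "real \<Rightarrow> real \<Rightarrow> (real \<Rightarrow> real) \<Rightarrow> bool" where
  "holding_cost lam a h \<longleftrightarrow>
     (\<forall>x. 0 \<le> h x) \<and>
     continuous_on UNIV h \<and> convex_on UNIV h \<and>
     C2_on (- {a}) h \<and> h a = 0 \<and>
     (\<forall>x<a. deriv h x < 0) \<and> (\<forall>x>a. 0 < deriv h x) \<and>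
     set_integrable lborel {..<a} (\<lambda>y. \<bar>deriv h y\<bar> * exp (lam * (y - a)))"

text \<open>The integral below is oriented: for \<open>x < a\<close> it is minus the integral over \<open>(x, a)\<close>.\<close>

definition g_fun ::
  "real \<Rightarrow> real \<Rightarrow> real \<Rightarrow> (real \<Rightarrow> real) \<Rightarrow> real \<Rightarrow> real \<Rightarrow> real \<Rightarrow> real" where
  "g_fun mu lam a h A B x =
     A - B * exp (- lam * (x - a))
       - lam / mu * (LBINT y=a..x. h y * exp (- lam * (x - y)))"

definition has_local_min_at :: "(real \<Rightarrow> real) \<Rightarrow> real \<Rightarrow> bool" where
  "has_local_min_at g x \<longleftrightarrow> (\<forall>\<^sub>F y in nhds x. g x \<le> g y)"

definition has_local_max_at :: "(real \<Rightarrow> real) \<Rightarrow> real \<Rightarrow> bool" where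
  "has_local_max_at g x \<longleftrightarrow> (\<forall>\<^sub>F y in nhds x. g y \<le> g x)"

text \<open>Monotonicity is strict.\<close>

definition turning_points :: "(real \<Rightarrow> real) \<Rightarrow> real \<Rightarrow> real \<Rightarrow> real \<Rightarrow> bool" where
  "turning_points g a x1 x2 \<longleftrightarrow>
     x1 < a \<and> a < x2 \<and> has_local_min_at g x1 \<and> has_local_max_at g x2 \<and>
     strict_antimono_on {..<x1} g \<and> strict_mono_on {x1<..<x2} g \<and> strict_antimono_on {x2<..} g"

end

theory Submission
  imports Defs
begin

text \<open>
  Let \<open>phi x\<close> stand for the integral of \<open>h' y * exp (lam * (y - a)) / mu\<close> over \<open>y\<close> from \<open>a\<close> to \<open>x\<close>.
  Integration by parts and \<open>h a = 0\<close> give \<open>g' x = lam * exp (- lam * (x - a)) * (B - phi x)\<close>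
  (\<open>g_deriv\<close>). Since \<open>phi\<close> falls strictly to \<open>phi a = 0\<close> and rises strictly afterwards, a number
  \<open>0 < B\<close> that \<open>phi\<close> attains to the left of \<open>a\<close> is attained once on each side, at \<open>x1\<close> and at
  \<open>x2\<close>, and \<open>g\<close> has a valley at \<open>x1\<close> and a hump at \<open>x2\<close>. The number \<open>A\<close> shifts the graph vertically,
  and a larger \<open>B\<close> lowers it everywhere, but more on the left than on the right. So raising \<open>B\<close>
  and \<open>A\<close> together can deepen the valley and heighten the hump at the same time.

  Existence is a variational argument. Relax the two area equations to inequalities: the area
  enclosed below \<open>-k\<close> over \<open>[d, D]\<close> is at least \<open>K\<close>, the area above \<open>l\<close> over \<open>[U, u]\<close> at least \<open>L\<close>, and
  \<open>d \<le> D \<le> U \<le> u\<close>. Among all sextuples that satisfy these, take one with the least \<open>B\<close>.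

  \<^item> Such sextuples exist because for \<open>B = phi c\<close> with \<open>c\<close> far to the left the rise of \<open>g\<close> from \<open>c + 2\<close>
    to \<open>a - 1\<close> is as large as desired (\<open>large_rise\<close>, \<open>feasible_exists\<close>).
  \<^item> The least \<open>B\<close> is attained because the sextuples can be clipped to a compact box
    (\<open>feasible_bounds\<close>, \<open>minimal_feasible\<close>).
  \<^item> At the minimum both area inequalities are equalities: slack in either one could be spent on a
    smaller \<open>B\<close> (\<open>slack_lowers_B\<close>).
  \<^item> Therefore no choice of the four endpoints enlarges one of the areas without reducing the other
    below its bound, and the first-order conditions at the endpoints are exactly \<open>g = -k\<close> at \<open>d\<close>
    and \<open>D\<close> and \<open>g = l\<close> at \<open>U\<close> and \<open>u\<close> (\<open>tight_endpoints\<close>).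

  For uniqueness, the difference of two functions \<open>g\<close> with \<open>B \<le> B'\<close> is nondecreasing in \<open>x\<close>. Hence the
  second is below the first on the whole valley \<open>[d, D]\<close> of the first, or above it on the whole hump
  \<open>[U, u]\<close>. The valley of a solution is the only interval up to \<open>u\<close> that encloses the area \<open>K\<close>, and its
  hump the only interval from \<open>d\<close> on that encloses \<open>L\<close> (\<open>well_optimal\<close>, \<open>hump_optimal\<close>), so the two
  valleys, or the two humps, have the same endpoints. Then the two functions agree at two points,
  which determines \<open>A\<close> and \<open>B\<close>.
\<close>

section \<open>Monotonicity, growth and largest drops\<close>

lemma strict_mono_on_from_deriv:
  fixes f :: "real \<Rightarrow> real"
  assumes "is_interval S" "continuous_on S f"
    and deriv: "\<And>x. x \<in> interior S \<Longrightarrow> \<exists>y. (f has_real_derivative y) (at x) \<and> 0 < y"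
  shows "strict_mono_on S f"
proof (rule strict_mono_onI)
  fix r s assume rs: "r \<in> S" "s \<in> S" "r < s"
  have sub: "{r..s} \<subseteq> S"
    using mem_is_interval_1_I[OF assms(1) rs(1,2)] by auto
  have inner: "{r<..<s} \<subseteq> interior S"
    by (rule interior_maximal) (use sub in auto)
  show "f r < f s"
  proof (rule DERIV_pos_imp_increasing_open[OF rs(3)])
    show "\<exists>y. (f has_real_derivative y) (at x) \<and> 0 < y" if "r < x" "x < s" for x
      by (rule deriv) (use that inner in auto)
  qed (rule continuous_on_subset[OF assms(2) sub])
qed

lemma strict_antimono_on_from_deriv:
  fixes f :: "real \<Rightarrow> real"
  assumes "is_interval S" "continuous_on S f"
    and deriv: "\<And>x. x \<in> interior S \<Longrightarrow> \<exists>y. (f has_real_derivative y) (at x) \<and> y < 0"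
  shows "strict_antimono_on S f"
proof -
  have "strict_mono_on S (\<lambda>x. - f x)"
  proof (rule strict_mono_on_from_deriv[OF assms(1)])
    show "continuous_on S (\<lambda>x. - f x)"
      by (intro continuous_intros assms)
    fix x assume "x \<in> interior S"
    then obtain y where "(f has_real_derivative y) (at x)" "y < 0"
      using deriv by blast
    then have "((\<lambda>x. - f x) has_real_derivative - y) (at x)" "0 < - y"
      by (auto intro: DERIV_minus)
    then show "\<exists>y. ((\<lambda>x. - f x) has_real_derivative y) (at x) \<and> 0 < y"
      by blast
  qed
  then have "f y < f x" if "x \<in> S" "y \<in> S" "x < y" for x y
    using strict_mono_onD[of S "\<lambda>x. - f x" x y] that by simp
  then show ?thesis
    by (intro monotone_onI)
qed

lemma growth_from_deriv:
  fixes f :: "real \<Rightarrow> real"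
  assumes "x \<le> y"
    and deriv: "\<And>z. x \<le> z \<Longrightarrow> z \<le> y \<Longrightarrow> \<exists>d. (f has_real_derivative d) (at z) \<and> m \<le> d"
  shows "m * (y - x) \<le> f y - f x"
proof -
  have "f x - m * x \<le> f y - m * y"
  proof (rule DERIV_nonneg_imp_nondecreasing[OF assms(1)])
    fix z assume "x \<le> z" "z \<le> y"
    then obtain d where d: "(f has_real_derivative d) (at z)" "m \<le> d"
      using deriv by blast
    have "((\<lambda>x. f x - m * x) has_real_derivative d - m) (at z)"
      by (auto intro!: derivative_eq_intros d(1))
    with d(2) show "\<exists>d. ((\<lambda>x. f x - m * x) has_real_derivative d) (at z) \<and> 0 \<le> d"
      by (intro exI[of _ "d - m"]) simp
  qed
  then show ?thesis by (simp add: algebra_simps)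
qed

text \<open>
  A function that rises, falls and rises again loses at most \<open>f s - f t\<close> between a point and a later
  one, because every rise on the way makes the loss smaller. Applied to primitives of \<open>g + k\<close> and of
  \<open>l - g\<close>, this says which interval carries the extremal area.
\<close>

lemma largest_drop_unique:
  fixes f :: "real \<Rightarrow> real"
  assumes up1: "strict_mono_on (S \<inter> {..s}) f" and down: "strict_antimono_on {s..t} f"
    and up2: "strict_mono_on (S \<inter> {t..}) f"
    and st: "s \<in> S" "t \<in> S" "s < t"
    and pr: "p \<in> S" "r \<in> S" "p \<le> r" and drop: "f r - f p \<le> f t - f s"
  shows "p = s \<and> r = t"
proof -
  have u1: "f x < f y" if "x \<in> S" "y \<in> S" "x < y" "y \<le> s" for x y
    using monotone_onD[OF up1 _ _ that(3)] that by simp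
  have d: "f y < f x" if "s \<le> x" "x < y" "y \<le> t" for x y
    using monotone_onD[OF down _ _ that(2)] that by simp
  have u2: "f x < f y" if "x \<in> S" "y \<in> S" "x < y" "t \<le> x" for x y
    using monotone_onD[OF up2 _ _ that(3)] that by simp
  have drop': "f r < f p"
    using drop d[of s t] st by linarith
  have "p \<le> t"
    using u2[of p r] pr drop' by (cases "p = r") force+
  moreover have "s \<le> r"
    using u1[of p r] pr drop' by (cases "p = r") force+
  ultimately have p: "p \<noteq> s \<Longrightarrow> f p < f s" and r: "r \<noteq> t \<Longrightarrow> f t < f r"
    using u1[of p s] d[of s p] d[of r t] u2[of t r] st pr by linarith+
  show ?thesis
  proof (rule ccontr)
    assume "\<not> ?thesis"
    then have "f t - f s < f r - f p"
      using p r by (cases "p = s"; cases "r = t") force+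
    with drop show False by linarith
  qed
qed

section \<open>Valley and hump of g\<close>

locale convex_cost_control =
  fixes mu lam a :: real and h :: "real \<Rightarrow> real" and K L k l :: real
  assumes mu_pos: "0 < mu" and lam_pos: "0 < lam" and cost: "holding_cost lam a h"
    and K_pos: "0 < K" and L_pos: "0 < L" and k_pos: "0 < k" and l_pos: "0 < l"
begin

abbreviation decay :: "real \<Rightarrow> real" where "decay x \<equiv> exp (- lam * (x - a))"

text \<open>
  The kernel \<open>exp (- lam * (x - y))\<close> in the integral of \<open>g\<close> splits into \<open>decay x\<close> and a factor that depends
  only on \<open>y\<close>. What remains is an integral that is easy to differentiate in its upper limit.
\<close>

definition cost_integral :: "real \<Rightarrow> real" where
  "cost_integral x = (LBINT y=a..x. h y * exp (lam * (y - a)))"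

text \<open>
  The part of \<open>-g\<close> that depends neither on \<open>A\<close> nor on \<open>B\<close>.
\<close>

definition q :: "real \<Rightarrow> real" where
  "q x = lam / mu * (decay x * cost_integral x)"

text \<open>
  The integral of \<open>h' y * exp (lam * (y - a)) / mu\<close> over \<open>y\<close> from \<open>a\<close> to \<open>x\<close>, after integration by parts.
  In this form it makes sense at \<open>a\<close>, where \<open>h\<close> may have a kink.
\<close>

definition phi :: "real \<Rightarrow> real" where
  "phi x = (h x * exp (lam * (x - a)) - lam * cost_integral x) / mu"

abbreviation g :: "real \<Rightarrow> real \<Rightarrow> real \<Rightarrow> real" where
  "g \<equiv> g_fun mu lam a h"

lemma g_eq: "g A B x = A - B * decay x - q x"
proof -
  have "h y * exp (- lam * (x - y)) = decay x * (h y * exp (lam * (y - a)))" for y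
  proof -
    have "exp (- lam * (x - y)) = decay x * exp (lam * (y - a))"
      by (simp add: exp_add[symmetric] algebra_simps)
    then show ?thesis by simp
  qed
  then have "(LBINT y=a..x. h y * exp (- lam * (x - y))) = decay x * cost_integral x"
    unfolding cost_integral_def by (simp only: interval_lebesgue_integral_mult_right)
  then show ?thesis
    unfolding g_fun_def q_def by (simp only: times_divide_eq_left)
qed

lemma antiderivative_from_integral:
  fixes f :: "real \<Rightarrow> real" and c x :: real
  assumes "continuous_on UNIV f"
  shows "((\<lambda>u. LBINT y=c..u. f y) has_real_derivative f x) (at x)"
proof -
  let ?p = "min c x - 1" and ?q = "max c x + 1"
  have "((\<lambda>u. LBINT y=c..u. f y) has_vector_derivative f x) (at x within {?p..?q})"
    by (rule interval_integral_FTC2) (auto intro: continuous_on_subset[OF assms])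
  moreover have "at x within {?p..?q} = at x"
    by (rule at_within_Icc_at) auto
  ultimately show ?thesis
    by (simp add: has_real_derivative_iff_has_vector_derivative)
qed

lemma h_cont: "continuous_on S h"
  using cost continuous_on_subset unfolding holding_cost_def by blast

lemma cost_integral_deriv: "(cost_integral has_real_derivative h x * exp (lam * (x - a))) (at x)"
  unfolding cost_integral_def by (rule antiderivative_from_integral) (intro continuous_intros h_cont)

lemma cost_integral_cont: "continuous_on S cost_integral"
  by (meson DERIV_isCont cost_integral_deriv continuous_at_imp_continuous_on)

lemma h_deriv: "(h has_real_derivative deriv h x) (at x)" if "x \<noteq> a"
proof -
  have "h differentiable_on (- {a})"
    using cost unfolding holding_cost_def C2_on_def by blast
  then have "h differentiable (at x)"
    using that differentiable_on_eq_differentiable_at[of "- {a}" h] by auto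
  then show ?thesis
    by (simp add: DERIV_deriv_iff_real_differentiable)
qed

lemma h_deriv_neg: "x < a \<Longrightarrow> deriv h x < 0"
  and h_deriv_pos: "a < x \<Longrightarrow> 0 < deriv h x"
  and h_at_a: "h a = 0"
  using cost unfolding holding_cost_def by blast+

lemma h_deriv_mono: "deriv h x \<le> deriv h y" if "x < y" "x \<noteq> a" "y \<noteq> a"
proof -
  have cv: "convex_on UNIV h"
    using cost unfolding holding_cost_def by blast
  have "deriv h x * (y - x) \<le> h y - h x" "deriv h y * (x - y) \<le> h x - h y"
    using that by (intro convex_on_imp_above_tangent[OF cv]; simp add: h_deriv)+
  then have "(deriv h x - deriv h y) * (y - x) \<le> 0"
    by (simp add: algebra_simps)
  with that show ?thesis
    by (simp add: mult_le_0_iff)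
qed

lemma phi_deriv:
  "(phi has_real_derivative deriv h x * exp (lam * (x - a)) / mu) (at x)" if "x \<noteq> a"
  unfolding phi_def using mu_pos
  by (auto intro!: derivative_eq_intros h_deriv[OF that] cost_integral_deriv simp: field_simps)

lemma phi_cont: "continuous_on S phi"
  unfolding phi_def using mu_pos by (intro continuous_intros h_cont cost_integral_cont) auto

lemma phi_at_a: "phi a = 0"
  by (simp add: phi_def cost_integral_def h_at_a)

lemma phi_decreasing: "strict_antimono_on {..a} phi"
proof (rule strict_antimono_on_from_deriv)
  fix x assume "x \<in> interior {..a}"
  then have "x < a" by simp
  then have "deriv h x * exp (lam * (x - a)) / mu < 0"
    using h_deriv_neg mu_pos by (intro divide_neg_pos mult_neg_pos) auto
  then show "\<exists>y. (phi has_real_derivative y) (at x) \<and> y < 0"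
    using phi_deriv[of x] \<open>x < a\<close> by blast
qed (auto simp: is_interval_1 phi_cont)

lemma phi_increasing: "strict_mono_on {a..} phi"
proof (rule strict_mono_on_from_deriv)
  fix x assume "x \<in> interior {a..}"
  then have "a < x" by simp
  then have "0 < deriv h x * exp (lam * (x - a)) / mu"
    using h_deriv_pos mu_pos by (intro divide_pos_pos mult_pos_pos) auto
  then show "\<exists>y. (phi has_real_derivative y) (at x) \<and> 0 < y"
    using phi_deriv[of x] \<open>a < x\<close> by blast
qed (auto simp: is_interval_1 phi_cont)

lemma phi_nonneg: "0 \<le> phi x"
  using monotone_onD[OF phi_decreasing, of x a] monotone_onD[OF phi_increasing, of a x] phi_at_a
  by (cases x a rule: linorder_cases) auto

lemma q_deriv: "(q has_real_derivative lam * decay x * phi x) (at x)"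
proof -
  have "decay x * exp (lam * (x - a)) = 1"
    by (simp add: exp_add[symmetric])
  then have [simp]: "h x * (exp (lam * (x - a)) * decay x) = h x" "h x * (decay x * exp (lam * (x - a))) = h x"
    by (simp_all add: mult.commute)
  show ?thesis
    unfolding q_def phi_def using mu_pos
    by (auto intro!: derivative_eq_intros cost_integral_deriv simp: field_simps)
qed

lemma q_cont: "continuous_on S q"
  by (meson DERIV_isCont q_deriv continuous_at_imp_continuous_on)

lemma g_deriv: "(g A B has_real_derivative lam * decay x * (B - phi x)) (at x)"
  unfolding g_eq[abs_def]
  by (auto intro!: derivative_eq_intros q_deriv simp: algebra_simps)

lemma g_cont: "continuous_on S (g A B)"
  by (meson DERIV_isCont g_deriv continuous_at_imp_continuous_on)

lemma q_mono: "q x \<le> q y" if "x \<le> y"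
proof (rule DERIV_nonneg_imp_nondecreasing[OF that])
  fix z
  have "0 \<le> lam * decay z * phi z"
    using phi_nonneg lam_pos by simp
  then show "\<exists>d. (q has_real_derivative d) (at z) \<and> 0 \<le> d"
    using q_deriv by blast
qed

text \<open>
  The bounds hold for all \<open>B \<le> B1\<close> with the same \<open>c1\<close> and \<open>c2\<close>: wherever \<open>phi\<close> exceeds \<open>B1\<close> it exceeds \<open>B\<close>. This
  uniformity is what confines the valley and the hump while \<open>B\<close> varies.
\<close>

lemma g_decreasing_outside:
  assumes "c1 < a" "a < c2" "phi c1 = B1" "phi c2 = B1" "B \<le> B1"
  shows "strict_antimono_on {..c1} (g A B)" "strict_antimono_on {c2..} (g A B)"
proof -
  have sgn: "B < phi x" if "x < c1 \<or> c2 < x" for x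
    using that assms monotone_onD[OF phi_decreasing, of x c1]
      monotone_onD[OF phi_increasing, of c2 x] by auto
  have neg: "lam * decay x * (B - phi x) < 0" if "x < c1 \<or> c2 < x" for x
    using sgn[OF that] lam_pos by (intro mult_pos_neg) auto
  show "strict_antimono_on {..c1} (g A B)" "strict_antimono_on {c2..} (g A B)"
    by (rule strict_antimono_on_from_deriv;
        use neg g_deriv[of A B] in \<open>auto simp: is_interval_1 g_cont\<close>)+
qed

lemma g_piecewise:
  assumes "x1 < a" "a < x2" "phi x1 = B" "phi x2 = B"
  shows "strict_antimono_on {..x1} (g A B)" "strict_mono_on {x1..x2} (g A B)"
    "strict_antimono_on {x2..} (g A B)"
proof -
  show "strict_antimono_on {..x1} (g A B)" "strict_antimono_on {x2..} (g A B)"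
    using g_decreasing_outside[OF assms order_refl] by blast+
  have sgn: "phi x < B" if "x1 < x" "x < x2" for x
    using that assms monotone_onD[OF phi_decreasing, of x1 x]
      monotone_onD[OF phi_increasing, of x x2] by (cases "x \<le> a") auto
  have pos: "0 < lam * decay x * (B - phi x)" if "x1 < x" "x < x2" for x
    using sgn[OF that] lam_pos by (intro mult_pos_pos) auto
  show "strict_mono_on {x1..x2} (g A B)"
    by (rule strict_mono_on_from_deriv;
        use pos g_deriv[of A B] in \<open>auto simp: is_interval_1 g_cont\<close>)
qed

text \<open>
  At a local extremum \<open>g'\<close> vanishes, and it vanishes only where \<open>phi x = B\<close>. The turning points are
  thus determined by \<open>B\<close>, and the strict monotonicity extends to the closed intervals.
\<close>

lemma turning_points_iff:
  "turning_points (g A B) a x1 x2 \<longleftrightarrow> x1 < a \<and> a < x2 \<and> phi x1 = B \<and> phi x2 = B"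
proof
  assume tp: "turning_points (g A B) a x1 x2"
  then have "has_local_min_at (g A B) x1" "has_local_max_at (g A B) x2"
    by (simp_all only: turning_points_def)
  then obtain e1 e2 where "0 < e1" "\<forall>y. dist y x1 < e1 \<longrightarrow> g A B x1 \<le> g A B y"
    and e2: "0 < e2" "\<forall>y. dist y x2 < e2 \<longrightarrow> g A B y \<le> g A B x2"
    unfolding has_local_min_at_def has_local_max_at_def eventually_nhds_metric by blast
  then have 1: "lam * decay x1 * (B - phi x1) = 0"
    by (intro DERIV_local_min[OF g_deriv[of A B x1], of e1]) (simp_all add: dist_real_def abs_minus_commute)
  from e2 have "lam * decay x2 * (B - phi x2) = 0"
    by (intro DERIV_local_max[OF g_deriv[of A B x2], of e2]) (simp_all add: dist_real_def abs_minus_commute)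
  with 1 have "phi x1 = B" "phi x2 = B"
    using lam_pos by simp_all
  moreover have "x1 < a" "a < x2"
    using tp by (simp_all only: turning_points_def)
  ultimately show "x1 < a \<and> a < x2 \<and> phi x1 = B \<and> phi x2 = B"
    by (intro conjI)
next
  assume "x1 < a \<and> a < x2 \<and> phi x1 = B \<and> phi x2 = B"
  then have x: "x1 < a" "a < x2" "phi x1 = B" "phi x2 = B"
    by simp_all
  note mono = g_piecewise[OF x, of A]
  have "g A B x1 \<le> g A B y" if "y < x2" for y
    using that x monotone_onD[OF mono(1), of y x1] monotone_onD[OF mono(2), of x1 y]
    by (cases x1 y rule: linorder_cases) auto
  then have "has_local_min_at (g A B) x1"
    unfolding has_local_min_at_def eventually_nhds using x
    by (intro exI[of _ "{..<x2}"]) simp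
  moreover have "g A B y \<le> g A B x2" if "x1 < y" for y
    using that x monotone_onD[OF mono(3), of x2 y] monotone_onD[OF mono(2), of y x2]
    by (cases x2 y rule: linorder_cases) auto
  then have "has_local_max_at (g A B) x2"
    unfolding has_local_max_at_def eventually_nhds using x
    by (intro exI[of _ "{x1<..}"]) simp
  moreover have "strict_antimono_on {..<x1} (g A B)"
    by (rule monotone_on_subset[OF mono(1)]) auto
  moreover have "strict_mono_on {x1<..<x2} (g A B)"
    by (rule monotone_on_subset[OF mono(2)]) auto
  moreover have "strict_antimono_on {x2<..} (g A B)"
    by (rule monotone_on_subset[OF mono(3)]) auto
  ultimately show "turning_points (g A B) a x1 x2"
    using x unfolding turning_points_def by (intro conjI) simp_all
qed

section \<open>Growth at infinity\<close>

text \<open>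
  By convexity \<open>h'\<close> is at most \<open>h' (a - 1) < 0\<close> to the left of \<open>a - 1\<close>, so \<open>phi\<close> changes there at least as
  fast as if \<open>h'\<close> were this constant.
\<close>

lemma phi_growth_left:
  obtains s where "0 < s"
    "\<And>x y. x \<le> y \<Longrightarrow> y \<le> a - 1 \<Longrightarrow>
       s * (exp (lam * (y - a)) - exp (lam * (x - a))) \<le> lam * (phi x - phi y)"
proof -
  define s where "s = - deriv h (a - 1) / mu"
  have s: "0 < s"
    using h_deriv_neg[of "a - 1"] mu_pos unfolding s_def by (simp add: divide_neg_pos)
  have "s * (exp (lam * (y - a)) - exp (lam * (x - a))) \<le> lam * (phi x - phi y)"
    if "x \<le> y" "y \<le> a - 1" for x y
  proof -
    let ?f = "\<lambda>z. lam * phi z + s * exp (lam * (z - a))"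
    have "?f y \<le> ?f x"
    proof (rule DERIV_nonpos_imp_nonincreasing[OF that(1)])
      fix z assume z: "x \<le> z" "z \<le> y"
      have "deriv h z \<le> deriv h (a - 1)"
        using h_deriv_mono[of z "a - 1"] z that by (cases "z = a - 1") auto
      then have "(deriv h z / mu + s) \<le> 0"
        using mu_pos by (simp add: s_def field_simps)
      then have "lam * exp (lam * (z - a)) * (deriv h z / mu + s) \<le> 0"
        using lam_pos by (intro mult_nonneg_nonpos) auto
      moreover have "(?f has_real_derivative lam * exp (lam * (z - a)) * (deriv h z / mu + s)) (at z)"
        using z that by (auto intro!: derivative_eq_intros phi_deriv simp: algebra_simps)
      ultimately show "\<exists>d. (?f has_real_derivative d) (at z) \<and> d \<le> 0"
        by blast
    qed
    then show ?thesis by (simp add: algebra_simps)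
  qed
  with s that show thesis by blast
qed

lemma phi_growth_right:
  obtains s where "0 < s"
    "\<And>x y. a + 1 \<le> x \<Longrightarrow> x \<le> y \<Longrightarrow>
       s * (exp (lam * (y - a)) - exp (lam * (x - a))) \<le> lam * (phi y - phi x)"
proof -
  define s where "s = deriv h (a + 1) / mu"
  have s: "0 < s"
    using h_deriv_pos[of "a + 1"] mu_pos unfolding s_def by simp
  have "s * (exp (lam * (y - a)) - exp (lam * (x - a))) \<le> lam * (phi y - phi x)"
    if "a + 1 \<le> x" "x \<le> y" for x y
  proof -
    let ?f = "\<lambda>z. lam * phi z - s * exp (lam * (z - a))"
    have "?f x \<le> ?f y"
    proof (rule DERIV_nonneg_imp_nondecreasing[OF that(2)])
      fix z assume z: "x \<le> z" "z \<le> y"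
      have "deriv h (a + 1) \<le> deriv h z"
        using h_deriv_mono[of "a + 1" z] z that by (cases "z = a + 1") auto
      then have "0 \<le> deriv h z / mu - s"
        using mu_pos by (simp add: s_def field_simps)
      then have "0 \<le> lam * exp (lam * (z - a)) * (deriv h z / mu - s)"
        using lam_pos by (intro mult_nonneg_nonneg) auto
      moreover have "(?f has_real_derivative lam * exp (lam * (z - a)) * (deriv h z / mu - s)) (at z)"
        using z that by (auto intro!: derivative_eq_intros phi_deriv simp: algebra_simps)
      ultimately show "\<exists>d. (?f has_real_derivative d) (at z) \<and> 0 \<le> d"
        by blast
    qed
    then show ?thesis by (simp add: algebra_simps)
  qed
  with s that show thesis by blast
qed

text \<open>
  The right-hand sides are \<open>g'\<close> at \<open>y\<close> for \<open>B = phi x\<close> and \<open>-g'\<close> at \<open>x\<close> for \<open>B = phi y\<close>.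
\<close>

lemma phi_drop_bounds:
  obtains s where "0 < s"
    "\<And>x y. x \<le> y \<Longrightarrow> y \<le> a - 1 \<Longrightarrow> s * (1 - exp (- lam * (y - x))) \<le> lam * decay y * (phi x - phi y)"
    "\<And>x y. x \<le> y \<Longrightarrow> y \<le> a - 1 \<Longrightarrow> s * (exp (lam * (y - x)) - 1) \<le> lam * decay x * (phi x - phi y)"
proof -
  obtain s where s: "0 < s" "\<And>x y. x \<le> y \<Longrightarrow> y \<le> a - 1 \<Longrightarrow>
       s * (exp (lam * (y - a)) - exp (lam * (x - a))) \<le> lam * (phi x - phi y)"
    using phi_growth_left by blast
  have *: "s * (decay z * exp (lam * (y - a)) - decay z * exp (lam * (x - a))) \<le> lam * decay z * (phi x - phi y)"
    if "x \<le> y" "y \<le> a - 1" for x y z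
    using mult_left_mono[OF s(2)[OF that], of "decay z"] by (simp add: algebra_simps)
  have e: "decay z * exp (lam * (x - a)) = exp (lam * (x - z))" for x z
    by (simp add: exp_add[symmetric] algebra_simps)
  have m: "exp (- lam * (y - x)) = exp (lam * (x - y))" for x y
    by (simp add: algebra_simps)
  show thesis
  proof (rule that[OF s(1)])
    fix x y :: real assume xy: "x \<le> y" "y \<le> a - 1"
    show "s * (1 - exp (- lam * (y - x))) \<le> lam * decay y * (phi x - phi y)"
      using *[OF xy, of y] unfolding e by (subst m) simp
    show "s * (exp (lam * (y - x)) - 1) \<le> lam * decay x * (phi x - phi y)"
      using *[OF xy, of x] unfolding e by simp
  qed
qed

text \<open>
  To the left of \<open>c - 1\<close> the slope of \<open>g\<close> is at most a negative constant, by \<open>phi_drop_bounds\<close>.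
\<close>

lemma g_unbounded_left:
  assumes "c \<le> a - 1"
  obtains d0 where "\<And>x. x \<le> d0 \<Longrightarrow> M < g A (phi c) x"
proof -
  obtain s where s: "0 < s" and
    "\<And>x y. x \<le> y \<Longrightarrow> y \<le> a - 1 \<Longrightarrow> s * (1 - exp (- lam * (y - x))) \<le> lam * decay y * (phi x - phi y)"
    and gap:
    "\<And>x y. x \<le> y \<Longrightarrow> y \<le> a - 1 \<Longrightarrow> s * (exp (lam * (y - x)) - 1) \<le> lam * decay x * (phi x - phi y)"
    using phi_drop_bounds by blast
  let ?B = "phi c"
  define m where "m = s * lam"
  have m: "0 < m" using s lam_pos by (simp add: m_def)
  have low: "m * (c - 1 - x) \<le> g A ?B x - g A ?B (c - 1)" if "x \<le> c - 1" for x
  proof -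
    have "m * ((c - 1) - x) \<le> (- g A ?B (c - 1)) - (- g A ?B x)"
    proof (rule growth_from_deriv[OF that])
      fix z assume z: "x \<le> z" "z \<le> c - 1"
      have "lam * 1 \<le> lam * (c - z)"
        using lam_pos z by (intro mult_left_mono) auto
      then have "lam \<le> exp (lam * (c - z)) - 1"
        using exp_ge_add_one_self[of "lam * (c - z)"] by linarith
      then have "m \<le> s * (exp (lam * (c - z)) - 1)"
        unfolding m_def using s by (intro mult_left_mono) auto
      also have "\<dots> \<le> lam * decay z * (phi z - phi c)"
        using gap[of z c] z assms by simp
      finally have "m \<le> - (lam * decay z * (?B - phi z))"
        by (simp add: algebra_simps)
      then show "\<exists>d. ((\<lambda>x. - g A ?B x) has_real_derivative d) (at z) \<and> m \<le> d"
        using DERIV_minus[OF g_deriv] by blast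
    qed
    then show ?thesis by simp
  qed
  define t where "t = (\<bar>M - g A ?B (c - 1)\<bar> + 1) / m"
  have t: "0 \<le> t" "m * t = \<bar>M - g A ?B (c - 1)\<bar> + 1"
    using m by (simp_all add: t_def)
  have "M < g A ?B x" if "x \<le> c - 1 - t" for x
  proof -
    have "m * t \<le> m * (c - 1 - x)"
      using that m by (intro mult_left_mono) auto
    then show ?thesis
      using low[of x] t that by linarith
  qed
  then show thesis by (rule that)
qed

lemma q_unbounded_right:
  obtains u0 where "\<And>x. u0 \<le> x \<Longrightarrow> M < q x"
proof -
  obtain s where s: "0 < s" "\<And>x y. a + 1 \<le> x \<Longrightarrow> x \<le> y \<Longrightarrow>
       s * (exp (lam * (y - a)) - exp (lam * (x - a))) \<le> lam * (phi y - phi x)"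
    using phi_growth_right by blast
  define m where "m = s * (1 - exp (- lam))"
  have m: "0 < m" using s(1) lam_pos by (simp add: m_def)
  have low: "m * (x - (a + 2)) \<le> q x - q (a + 2)" if "a + 2 \<le> x" for x
  proof (rule growth_from_deriv[OF that])
    fix z assume z: "a + 2 \<le> z" "z \<le> x"
    have e: "decay z * exp (lam * (z - a)) = 1" "decay z * exp (lam * 1) = exp (- (lam * (z - a - 1)))"
      by (simp_all add: exp_add[symmetric] algebra_simps)
    have "lam * 1 \<le> lam * (z - a - 1)"
      using z lam_pos by (intro mult_left_mono) auto
    then have "m \<le> s * (1 - exp (- (lam * (z - a - 1))))"
      unfolding m_def using s(1) by (intro mult_left_mono) auto
    also have "\<dots> = decay z * (s * (exp (lam * (z - a)) - exp (lam * 1)))"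
      using e by (simp add: algebra_simps)
    also have "\<dots> \<le> decay z * (lam * phi z)"
    proof (rule mult_left_mono)
      have "s * (exp (lam * (z - a)) - exp (lam * 1)) \<le> lam * phi z - lam * phi (a + 1)"
        using s(2)[of "a + 1" z] z by (simp add: algebra_simps)
      then show "s * (exp (lam * (z - a)) - exp (lam * 1)) \<le> lam * phi z"
        using mult_nonneg_nonneg[OF less_imp_le[OF lam_pos] phi_nonneg[of "a + 1"]] by linarith
    qed simp
    finally show "\<exists>d. (q has_real_derivative d) (at z) \<and> m \<le> d"
      using q_deriv[of z] by (intro exI[of _ "lam * decay z * phi z"]) (simp add: mult_ac)
  qed
  define t where "t = (\<bar>M - q (a + 2)\<bar> + 1) / m"
  have t: "0 \<le> t" "m * t = \<bar>M - q (a + 2)\<bar> + 1"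
    using m by (auto simp: t_def field_simps)
  have "M < q x" if "a + 2 + t \<le> x" for x
  proof -
    have "m * t \<le> m * (x - (a + 2))"
      using that m by (intro mult_left_mono) auto
    then show ?thesis
      using low[of x] t that by linarith
  qed
  then show thesis by (rule that)
qed

lemma phi_unbounded_right:
  obtains x where "a \<le> x" "b \<le> phi x"
proof -
  obtain s where s: "0 < s" "\<And>x y. a + 1 \<le> x \<Longrightarrow> x \<le> y \<Longrightarrow>
       s * (exp (lam * (y - a)) - exp (lam * (x - a))) \<le> lam * (phi y - phi x)"
    using phi_growth_right by blast
  define t where "t = \<bar>b\<bar> / s"
  have t: "0 \<le> t" "s * t = \<bar>b\<bar>"
    using s(1) by (auto simp: t_def)
  have "lam * t \<le> exp (lam * t) - 1"
    using exp_ge_add_one_self[of "lam * t"] by linarith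
  also have "\<dots> \<le> exp lam * (exp (lam * t) - 1)"
  proof -
    have "1 * (exp (lam * t) - 1) \<le> exp lam * (exp (lam * t) - 1)"
      using lam_pos t by (intro mult_right_mono) auto
    then show ?thesis by simp
  qed
  also have "\<dots> = exp (lam * (a + 1 + t - a)) - exp (lam * (a + 1 - a))"
    by (simp add: exp_add[symmetric] algebra_simps)
  finally have "s * (lam * t) \<le> s * (exp (lam * (a + 1 + t - a)) - exp (lam * (a + 1 - a)))"
    using s(1) by (intro mult_left_mono) auto
  also have "\<dots> \<le> lam * (phi (a + 1 + t) - phi (a + 1))"
    using t by (intro s(2)) auto
  finally have "s * (lam * t) \<le> lam * (phi (a + 1 + t) - phi (a + 1))" .
  then have "lam * (s * t) \<le> lam * (phi (a + 1 + t) - phi (a + 1))"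
    by (simp add: mult_ac)
  then have "s * t \<le> phi (a + 1 + t) - phi (a + 1)"
    using lam_pos by simp
  then have "b \<le> phi (a + 1 + t)"
    using t phi_nonneg[of "a + 1"] by linarith
  with t show thesis
    by (intro that[of "a + 1 + t"]) auto
qed

text \<open>
  With \<open>B = phi c\<close> the slope of \<open>g\<close> on \<open>[c + 2, a - 1]\<close> is bounded below by a positive constant that does not
  depend on \<open>c\<close>, so the rise over this interval grows at least linearly as \<open>c\<close> moves to the left.
\<close>

lemma large_rise:
  obtains c where "c \<le> a - 3" "M \<le> g A (phi c) (a - 1) - g A (phi c) (c + 2)"
proof -
  obtain s where s: "0 < s" and gap:
    "\<And>x y. x \<le> y \<Longrightarrow> y \<le> a - 1 \<Longrightarrow> s * (1 - exp (- lam * (y - x))) \<le> lam * decay y * (phi x - phi y)"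
    and
    "\<And>x y. x \<le> y \<Longrightarrow> y \<le> a - 1 \<Longrightarrow> s * (exp (lam * (y - x)) - 1) \<le> lam * decay x * (phi x - phi y)"
    using phi_drop_bounds by blast
  define m where "m = s * (1 - exp (- lam))"
  have m: "0 < m" using s lam_pos by (simp add: m_def)
  define c where "c = a - 3 - \<bar>M\<bar> / m"
  have c: "c \<le> a - 3" "m * (a - 3 - c) = \<bar>M\<bar>"
    using m by (auto simp: c_def)
  have "m * ((a - 1) - (c + 2)) \<le> g A (phi c) (a - 1) - g A (phi c) (c + 2)"
  proof (rule growth_from_deriv)
    fix z assume z: "c + 2 \<le> z" "z \<le> a - 1"
    have "lam * 1 \<le> lam * (z - c)"
      using z lam_pos by (intro mult_left_mono) auto
    then have "m \<le> s * (1 - exp (- lam * (z - c)))"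
      unfolding m_def using s by (intro mult_left_mono) auto
    also have "\<dots> \<le> lam * decay z * (phi c - phi z)"
      using gap[of c z] z by simp
    finally show "\<exists>d. (g A (phi c) has_real_derivative d) (at z) \<and> m \<le> d"
      using g_deriv by blast
  qed (use c in simp)
  moreover have "(a - 1) - (c + 2) = a - 3 - c" by simp
  ultimately have "M \<le> g A (phi c) (a - 1) - g A (phi c) (c + 2)"
    using c(2) by simp
  with c(1) show thesis by (rule that)
qed

text \<open>
  For \<open>0 < B \<le> phi c\<close> with \<open>c < a\<close>, the intermediate value theorem on both sides of \<open>a\<close> gives the
  two turning points.
\<close>

lemma phi_level:
  assumes "c < a" "0 < B" "B \<le> phi c"
  obtains x1 x2 where "c \<le> x1" "x1 < a" "a < x2" "phi x1 = B" "phi x2 = B"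
proof -
  have "\<exists>x\<ge>c. x \<le> a \<and> phi x = B"
    using assms phi_at_a by (intro IVT2') (auto simp: phi_cont)
  then obtain x1 where x1: "c \<le> x1" "x1 \<le> a" "phi x1 = B" by blast
  obtain b where b: "a \<le> b" "B \<le> phi b"
    using phi_unbounded_right by blast
  have "\<exists>x\<ge>a. x \<le> b \<and> phi x = B"
    using assms phi_at_a b by (intro IVT') (auto simp: phi_cont)
  then obtain x2 where x2: "a \<le> x2" "phi x2 = B" by blast
  have "x1 \<noteq> a" "x2 \<noteq> a"
    using x1 x2 assms phi_at_a by auto
  with x1 x2 show thesis
    by (intro that[of x1 x2]) auto
qed

section \<open>Areas as increments of a primitive\<close>

definition Q :: "real \<Rightarrow> real" where
  "Q x = (LBINT y=a..x. q y)"

text \<open>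
  A primitive of \<open>g A B\<close>. It is affine in \<open>(A, B)\<close>, so changing these two numbers changes areas by explicit
  amounts, and it is jointly continuous in all its arguments.
\<close>

definition F :: "real \<Rightarrow> real \<Rightarrow> real \<Rightarrow> real" where
  "F A B x = A * x + B / lam * decay x - Q x"

lemma Q_deriv: "(Q has_real_derivative q x) (at x)"
  unfolding Q_def by (intro antiderivative_from_integral q_cont)

lemma Q_cont: "continuous_on S Q"
  by (meson DERIV_isCont Q_deriv continuous_at_imp_continuous_on)

lemma F_deriv: "(F A B has_real_derivative g A B x) (at x)"
  unfolding F_def g_eq using lam_pos
  by (auto intro!: derivative_eq_intros Q_deriv)

lemma F_plus_linear_deriv: "((\<lambda>x. F A B x + c * x) has_real_derivative g A B x + c) (at x)"
  by (auto intro!: derivative_eq_intros F_deriv)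

lemma F_cont: "continuous_on S (F A B)"
  by (meson DERIV_isCont F_deriv continuous_at_imp_continuous_on)

lemma area_eq:
  fixes p r c :: real
  shows "(LBINT x=p..r. g A B x + c) = (F A B r + c * r) - (F A B p + c * p)"
  by (rule interval_integral_FTC_finite)
    (auto intro!: continuous_intros g_cont has_field_derivative_at_within F_plus_linear_deriv
      simp: has_real_derivative_iff_has_vector_derivative[symmetric])

lemma F_shift:
  "F (A + b) (B + c) x = F A B x + b * x + c / lam * decay x"
  by (simp add: F_def algebra_simps add_divide_distrib)

text \<open>
  The integrals of \<open>g + k\<close> over \<open>[d, D]\<close> and of \<open>g - l\<close> over \<open>[U, u]\<close>; see \<open>area_eq\<close>.
\<close>

definition lower_drop :: "real \<Rightarrow> real \<Rightarrow> real \<Rightarrow> real \<Rightarrow> real" where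
  "lower_drop A B d D = (F A B D + k * D) - (F A B d + k * d)"

definition upper_rise :: "real \<Rightarrow> real \<Rightarrow> real \<Rightarrow> real \<Rightarrow> real" where
  "upper_rise A B U u = (F A B u - l * u) - (F A B U - l * U)"

section \<open>Uniqueness\<close>

text \<open>
  The turning points enter through \<open>phi\<close>, as in \<open>turning_points_iff\<close>, and the areas through a primitive.
\<close>

definition solution where
  "solution A B x1 x2 d D U u \<longleftrightarrow>
     x1 < a \<and> a < x2 \<and> phi x1 = B \<and> phi x2 = B \<and>
     d < x1 \<and> x1 < D \<and> D < U \<and> U < x2 \<and> x2 < u \<and>
     lower_drop A B d D = - K \<and> upper_rise A B U u = L \<and>
     g A B d = - k \<and> g A B D = - k \<and> g A B U = l \<and> g A B u = l"

lemma solution_signs: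
  assumes "solution A B x1 x2 d D U u"
  shows "x < d \<Longrightarrow> - k < g A B x" "d < x \<Longrightarrow> x < D \<Longrightarrow> g A B x < - k"
    "D < x \<Longrightarrow> x < u \<Longrightarrow> - k < g A B x"
    "d < x \<Longrightarrow> x < U \<Longrightarrow> g A B x < l" "U < x \<Longrightarrow> x < u \<Longrightarrow> l < g A B x"
    "u < x \<Longrightarrow> g A B x < l"
proof -
  have x: "x1 < a" "a < x2" "phi x1 = B" "phi x2 = B"
    and o: "d < x1" "x1 < D" "D < U" "U < x2" "x2 < u"
    and v: "g A B d = - k" "g A B D = - k" "g A B U = l" "g A B u = l"
    using assms unfolding solution_def by blast+
  have dec1: "g A B y < g A B x" if "x < y" "y \<le> x1" for x y
    using monotone_onD[OF g_piecewise(1)[OF x], of x y] that by simp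
  have inc: "g A B x < g A B y" if "x1 \<le> x" "x < y" "y \<le> x2" for x y
    using monotone_onD[OF g_piecewise(2)[OF x], of x y] that by simp
  have dec2: "g A B y < g A B x" if "x2 \<le> x" "x < y" for x y
    using monotone_onD[OF g_piecewise(3)[OF x], of x y] that by simp
  show "- k < g A B x" if "x < d"
    using dec1[of x d] that o v by linarith
  show "g A B x < - k" if "d < x" "x < D"
    using dec1[of d x] inc[of x D] that o v by linarith
  show "- k < g A B x" if "D < x" "x < u"
    using inc[of D x] dec2[of x u] that o v k_pos l_pos by linarith
  show "g A B x < l" if "d < x" "x < U"
    using dec1[of d x] inc[of x U] that o v k_pos l_pos by linarith
  show "l < g A B x" if "U < x" "x < u"
    using inc[of U x] dec2[of x u] that o v by linarith
  show "g A B x < l" if "u < x"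
    using dec2[of u x] that o v by linarith
qed

text \<open>
  The integrand \<open>g + k\<close> is negative exactly on the valley, as long as one stays to the left of \<open>u\<close>. The
  restriction \<open>r \<le> u\<close> is essential: beyond \<open>u\<close> the function \<open>g\<close> tends to minus infinity.
\<close>

lemma well_optimal:
  assumes sol: "solution A B x1 x2 d D U u"
    and pr: "p \<le> r" "r \<le> u" "lower_drop A B p r \<le> - K"
  shows "p = d \<and> r = D"
proof (rule largest_drop_unique)
  let ?f = "\<lambda>x. F A B x + k * x"
  have o: "d < D" "D \<le> u"
    using sol unfolding solution_def by linarith+
  note der = F_plus_linear_deriv[of A B k]
  have cont: "continuous_on S ?f" for S
    by (intro continuous_intros F_cont)
  show "strict_mono_on ({..u} \<inter> {..d}) ?f"
  proof (rule strict_mono_on_from_deriv)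
    show "\<exists>y. (?f has_real_derivative y) (at x) \<and> 0 < y" if "x \<in> interior ({..u} \<inter> {..d})" for x
      using that solution_signs(1)[OF sol, of x]
      by (intro exI[of _ "g A B x + k"] conjI der) simp
  qed (simp add: is_interval_Int, rule cont)
  show "strict_antimono_on {d..D} ?f"
  proof (rule strict_antimono_on_from_deriv)
    show "\<exists>y. (?f has_real_derivative y) (at x) \<and> y < 0" if "x \<in> interior {d..D}" for x
      using that solution_signs(2)[OF sol, of x]
      by (intro exI[of _ "g A B x + k"] conjI der) simp
  qed (simp, rule cont)
  show "strict_mono_on ({..u} \<inter> {D..}) ?f"
  proof (rule strict_mono_on_from_deriv)
    show "\<exists>y. (?f has_real_derivative y) (at x) \<and> 0 < y" if "x \<in> interior ({..u} \<inter> {D..})" for x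
      using that solution_signs(3)[OF sol, of x]
      by (intro exI[of _ "g A B x + k"] conjI der) simp
  qed (simp add: is_interval_Int, rule cont)
  show "d \<in> {..u}" "D \<in> {..u}" "d < D" "p \<in> {..u}" "r \<in> {..u}" "p \<le> r"
    using o pr by simp_all
  show "?f r - ?f p \<le> ?f D - ?f d"
    using pr(3) sol unfolding solution_def lower_drop_def by linarith
qed

text \<open>
  The restriction \<open>d \<le> p\<close> is essential: far to the left of \<open>d\<close> the function \<open>g\<close> exceeds \<open>l\<close> again.
\<close>

lemma hump_optimal:
  assumes sol: "solution A B x1 x2 d D U u"
    and pr: "d \<le> p" "p \<le> r" "L \<le> upper_rise A B p r"
  shows "p = U \<and> r = u"
proof (rule largest_drop_unique)
  let ?f = "\<lambda>x. - (F A B x + (- l) * x)"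
  have o: "U < u" "d \<le> U"
    using sol unfolding solution_def by linarith+
  have der: "(?f has_real_derivative - (g A B x + - l)) (at x)" for x
    by (rule DERIV_minus[OF F_plus_linear_deriv])
  have cont: "continuous_on S ?f" for S
    by (intro continuous_intros F_cont)
  show "strict_mono_on ({d..} \<inter> {..U}) ?f"
  proof (rule strict_mono_on_from_deriv)
    show "\<exists>y. (?f has_real_derivative y) (at x) \<and> 0 < y" if "x \<in> interior ({d..} \<inter> {..U})" for x
      using that solution_signs(4)[OF sol, of x]
      by (intro exI[of _ "- (g A B x + - l)"] conjI der) simp
  qed (simp add: is_interval_Int, rule cont)
  show "strict_antimono_on {U..u} ?f"
  proof (rule strict_antimono_on_from_deriv)
    show "\<exists>y. (?f has_real_derivative y) (at x) \<and> y < 0" if "x \<in> interior {U..u}" for x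
      using that solution_signs(5)[OF sol, of x]
      by (intro exI[of _ "- (g A B x + - l)"] conjI der) simp
  qed (simp, rule cont)
  show "strict_mono_on ({d..} \<inter> {u..}) ?f"
  proof (rule strict_mono_on_from_deriv)
    show "\<exists>y. (?f has_real_derivative y) (at x) \<and> 0 < y" if "x \<in> interior ({d..} \<inter> {u..})" for x
      using that solution_signs(6)[OF sol, of x]
      by (intro exI[of _ "- (g A B x + - l)"] conjI der) simp
  qed (simp add: is_interval_Int, rule cont)
  show "U \<in> {d..}" "u \<in> {d..}" "U < u" "p \<in> {d..}" "r \<in> {d..}" "p \<le> r"
    using o pr by simp_all
  show "?f r - ?f p \<le> ?f u - ?f U"
    using pr(3) sol unfolding solution_def upper_rise_def by linarith
qed

text \<open>
  The valley \<open>[d, D]\<close> of the upper function encloses at least the area \<open>K\<close> under the lower one as well,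
  and \<open>well_optimal\<close> leaves only one such interval.
\<close>

lemma same_well:
  assumes s: "solution A B x1 x2 d D U u" and s': "solution A' B' x1' x2' d' D' U' u'"
    and le: "\<And>x. d \<le> x \<Longrightarrow> x \<le> D \<Longrightarrow> g A' B' x \<le> g A B x"
  shows "d' = d \<and> D' = D"
proof -
  have o: "d < x1" "x1 < a" "d < D" and o': "a < x2'" "x2' < u'" and v': "g A' B' u' = l"
    and K: "lower_drop A B d D = - K"
    using s s' unfolding solution_def by linarith+
  \<comment> \<open>Otherwise \<open>u'\<close>, which exceeds \<open>a\<close>, lies inside the valley, where the smaller function cannot be \<open>l\<close>.\<close>
  have "D \<le> u'"
  proof (rule ccontr)
    assume "\<not> D \<le> u'"
    then have "l \<le> g A B u'" "g A B u' < - k"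
      using le[of u'] solution_signs(2)[OF s, of u'] o o' v' by auto
    then show False using k_pos l_pos by linarith
  qed
  moreover have "lower_drop A' B' d D \<le> - K"
  proof -
    have "F A' B' D - F A B D \<le> F A' B' d - F A B d"
    proof (rule DERIV_nonpos_imp_nonincreasing[where f = "\<lambda>x. F A' B' x - F A B x"])
      fix x assume "d \<le> x" "x \<le> D"
      then show "\<exists>y. ((\<lambda>x. F A' B' x - F A B x) has_real_derivative y) (at x) \<and> y \<le> 0"
        using le[of x] by (intro exI[of _ "g A' B' x - g A B x"] conjI DERIV_diff F_deriv) simp
    qed (use o in simp)
    then show ?thesis
      using K unfolding lower_drop_def by linarith
  qed
  ultimately have "d = d' \<and> D = D'"
    using o by (intro well_optimal[OF s']) auto
  then show ?thesis by simp
qed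

lemma same_hump:
  assumes s: "solution A B x1 x2 d D U u" and s': "solution A' B' x1' x2' d' D' U' u'"
    and le: "\<And>x. U \<le> x \<Longrightarrow> x \<le> u \<Longrightarrow> g A B x \<le> g A' B' x"
  shows "U' = U \<and> u' = u"
proof -
  have o: "a < x2" "x2 < u" "U < u" and o': "d' < x1'" "x1' < a" and v': "g A' B' d' = - k"
    and L: "upper_rise A B U u = L"
    using s s' unfolding solution_def by linarith+
  have "d' \<le> U"
  proof (rule ccontr)
    assume "\<not> d' \<le> U"
    then have "g A B d' \<le> - k" "l < g A B d'"
      using le[of d'] solution_signs(5)[OF s, of d'] o o' v' by auto
    then show False using k_pos l_pos by linarith
  qed
  moreover have "L \<le> upper_rise A' B' U u"
  proof -
    have "F A' B' U - F A B U \<le> F A' B' u - F A B u"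
    proof (rule DERIV_nonneg_imp_nondecreasing[where f = "\<lambda>x. F A' B' x - F A B x"])
      fix x assume "U \<le> x" "x \<le> u"
      then show "\<exists>y. ((\<lambda>x. F A' B' x - F A B x) has_real_derivative y) (at x) \<and> 0 \<le> y"
        using le[of x] by (intro exI[of _ "g A' B' x - g A B x"] conjI DERIV_diff F_deriv) simp
    qed (use o in simp)
    then show ?thesis
      using L unfolding upper_rise_def by linarith
  qed
  ultimately have "U = U' \<and> u = u'"
    using o by (intro hump_optimal[OF s']) auto
  then show ?thesis by simp
qed

lemma g_diff: "g A' B' x - g A B x = (A' - A) - (B' - B) * decay x"
  by (simp add: g_eq algebra_simps)

lemma coefficients_from_two_points:
  assumes "p < r" "g A' B' p = g A B p" "g A' B' r = g A B r"
  shows "A' = A \<and> B' = B"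
proof -
  have "(B' - B) * decay p = (B' - B) * decay r"
    using assms g_diff[of A' B' p A B] g_diff[of A' B' r A B] by linarith
  moreover have "decay p \<noteq> decay r"
    using assms(1) lam_pos by simp
  ultimately have "B' = B" by simp
  then show ?thesis
    using assms(2) g_diff[of A' B' p A B] by simp
qed

lemma solution_unique_if_le:
  assumes s: "solution A B x1 x2 d D U u" and s': "solution A' B' x1' x2' d' D' U' u'"
    and "B \<le> B'"
  shows "A' = A \<and> B' = B \<and> d' = d \<and> D' = D \<and> U' = U \<and> u' = u"
proof -
  have o: "d < D" "D < U" "U < u"
    and v: "g A B d = - k" "g A B D = - k" "g A B U = l" "g A B u = l"
    and v': "g A' B' d' = - k" "g A' B' D' = - k" "g A' B' U' = l" "g A' B' u' = l"
    using s s' unfolding solution_def by linarith+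
  let ?e = "\<lambda>x. g A' B' x - g A B x"
  have mono: "?e x \<le> ?e y" if "x \<le> y" for x y
  proof -
    have "decay y \<le> decay x" using that lam_pos by simp
    then have "(B' - B) * decay y \<le> (B' - B) * decay x"
      using \<open>B \<le> B'\<close> by (intro mult_left_mono) auto
    then show ?thesis by (simp add: g_diff)
  qed
  \<comment> \<open>A nondecreasing difference is nonpositive on \<open>[d, D]\<close> or nonnegative on \<open>[U, u]\<close>, because \<open>D < U\<close>.\<close>
  have AB: "A' = A \<and> B' = B"
  proof (cases "?e D \<le> 0")
    case True
    have "d' = d \<and> D' = D"
    proof (rule same_well[OF s s'])
      show "g A' B' x \<le> g A B x" if "x \<le> D" for x
        using True mono[OF that] by linarith
    qed
    then show ?thesis
      using coefficients_from_two_points[OF o(1), of A' B' A B] v v' by simp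
  next
    case False
    have "U' = U \<and> u' = u"
    proof (rule same_hump[OF s s'])
      show "g A B x \<le> g A' B' x" if "U \<le> x" for x
        using False mono[of D x] o that by linarith
    qed
    then show ?thesis
      using coefficients_from_two_points[OF o(3), of A' B' A B] v v' by simp
  qed
  moreover have "d' = d \<and> D' = D"
    by (rule same_well[OF s s']) (simp add: AB)
  moreover have "U' = U \<and> u' = u"
    by (rule same_hump[OF s s']) (simp add: AB)
  ultimately show ?thesis by blast
qed

lemma solution_unique:
  assumes "solution A B x1 x2 d D U u" "solution A' B' x1' x2' d' D' U' u'"
  shows "A' = A \<and> B' = B \<and> d' = d \<and> D' = D \<and> U' = U \<and> u' = u"
  using solution_unique_if_le[OF assms] solution_unique_if_le[OF assms(2,1)]
  by (cases "B \<le> B'") auto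

section \<open>Existence by minimising B\<close>

definition feasible :: "real \<Rightarrow> real \<Rightarrow> real \<Rightarrow> real \<Rightarrow> real \<Rightarrow> real \<Rightarrow> bool" where
  "feasible A B d D U u \<longleftrightarrow>
     d \<le> D \<and> D \<le> U \<and> U \<le> u \<and> lower_drop A B d D \<le> - K \<and> L \<le> upper_rise A B U u"

text \<open>
  By the mean value theorem \<open>g\<close> is below \<open>-k\<close> at some point and above \<open>l\<close> at a later one. Every bound on
  the sextuple comes from this crossing.
\<close>

lemma feasible_crossing:
  assumes "feasible A B d D U u"
  obtains y z where "d < y" "y < D" "U < z" "z < u" "g A B y < - k" "l < g A B z"
proof -
  have o: "d \<le> D" "U \<le> u" and K: "lower_drop A B d D \<le> - K" and L: "L \<le> upper_rise A B U u"
    using assms unfolding feasible_def by simp_all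
  have "d \<noteq> D" "U \<noteq> u"
    using K L K_pos L_pos by (auto simp: lower_drop_def upper_rise_def)
  with o have o': "d < D" "U < u" by simp_all
  obtain y where y: "d < y" "y < D" "lower_drop A B d D = (D - d) * (g A B y + k)"
    unfolding lower_drop_def using MVT2[OF o'(1), of "\<lambda>x. F A B x + k * x" "\<lambda>x. g A B x + k"]
      F_plus_linear_deriv by blast
  obtain z where z: "U < z" "z < u"
    "(F A B u + (- l) * u) - (F A B U + (- l) * U) = (u - U) * (g A B z + (- l))"
    using MVT2[OF o'(2), of "\<lambda>x. F A B x + (- l) * x" "\<lambda>x. g A B x + (- l)"]
      F_plus_linear_deriv by blast
  have "(D - d) * (g A B y + k) < 0"
    using y K K_pos by linarith
  then have "g A B y < - k"
    using o' by (auto simp: mult_less_0_iff)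
  moreover have "0 < (u - U) * (g A B z + (- l))"
    using z L L_pos unfolding upper_rise_def by linarith
  then have "l < g A B z"
    using o' by (auto simp: zero_less_mult_iff)
  ultimately show thesis
    using y z by (intro that) auto
qed

text \<open>
  For \<open>B \<le> 0\<close> the function \<open>g\<close> is nonincreasing and cannot cross from \<open>-k\<close> up to \<open>l\<close>.
\<close>

lemma feasible_B_pos:
  assumes "feasible A B d D U u"
  shows "0 < B"
proof (rule ccontr)
  assume "\<not> 0 < B"
  obtain y z where yz: "y < D" "U < z" "g A B y < - k" "l < g A B z"
    using feasible_crossing[OF assms] by metis
  have "y \<le> z"
    using assms yz unfolding feasible_def by linarith
  then have "g A B z \<le> g A B y"
  proof (rule DERIV_nonpos_imp_nonincreasing)
    fix x
    have "lam * decay x * (B - phi x) \<le> 0"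
      using \<open>\<not> 0 < B\<close> phi_nonneg[of x] lam_pos by (intro mult_nonneg_nonpos) auto
    then show "\<exists>y. (g A B has_real_derivative y) (at x) \<and> y \<le> 0"
      using g_deriv by blast
  qed
  then show False
    using yz k_pos l_pos by linarith
qed

lemma feasible_exists:
  obtains A c d D U u where "c \<le> a - 1" "feasible A (phi c) d D U u"
proof -
  obtain c where c: "c \<le> a - 3" "k + K + l + L \<le> g 0 (phi c) (a - 1) - g 0 (phi c) (c + 2)"
    using large_rise[of "k + K + l + L" 0] by blast
  \<comment> \<open>This makes \<open>g = -k - K\<close> at \<open>c + 2\<close>. Since \<open>g\<close> increases on \<open>[c, a]\<close>, it is at most \<open>-k - K\<close> on an
      interval of length one that ends there, and at least \<open>l + L\<close> on \<open>[a - 1, a]\<close>.\<close>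
  define A where "A = - k - K - g 0 (phi c) (c + 2)"
  have gA: "g A (phi c) x = A + g 0 (phi c) x" for x
    by (simp add: g_eq)
  obtain x2 where x2: "a < x2" "phi x2 = phi c"
    using phi_level[of c "phi c"] c monotone_onD[OF phi_decreasing, of c a] phi_at_a by auto
  have inc: "g A (phi c) x \<le> g A (phi c) y" if "c \<le> x" "x \<le> y" "y \<le> a" for x y
    using monotone_onD[OF g_piecewise(2)[of c x2 "phi c" A], of x y] that c x2
    by (cases "x = y") auto
  note der = F_plus_linear_deriv[of A "phi c"]
  have "K * ((c + 2) - (c + 1)) \<le> (- (F A (phi c) (c + 2) + k * (c + 2))) - (- (F A (phi c) (c + 1) + k * (c + 1)))"
  proof (rule growth_from_deriv[where f = "\<lambda>x. - (F A (phi c) x + k * x)"])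
    fix z assume z: "c + 1 \<le> z" "z \<le> c + 2"
    have "K \<le> - (g A (phi c) z + k)"
      using inc[of z "c + 2"] z c gA[of "c + 2"] A_def by simp
    then show "\<exists>y. ((\<lambda>x. - (F A (phi c) x + k * x)) has_real_derivative y) (at z) \<and> K \<le> y"
      using DERIV_minus[OF der] by blast
  qed simp
  then have "lower_drop A (phi c) (c + 1) (c + 2) \<le> - K"
    unfolding lower_drop_def by simp
  moreover have "L * (a - (a - 1)) \<le> (F A (phi c) a + (- l) * a) - (F A (phi c) (a - 1) + (- l) * (a - 1))"
  proof (rule growth_from_deriv[where f = "\<lambda>x. F A (phi c) x + (- l) * x"])
    fix z assume z: "a - 1 \<le> z" "z \<le> a"
    have "L \<le> g A (phi c) z + (- l)"
      using inc[of "a - 1" z] z c gA[of "a - 1"] A_def by simp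
    then show "\<exists>y. ((\<lambda>x. F A (phi c) x + (- l) * x) has_real_derivative y) (at z) \<and> L \<le> y"
      using der by blast
  qed simp
  then have "L \<le> upper_rise A (phi c) (a - 1) a"
    unfolding upper_rise_def by simp
  ultimately have "feasible A (phi c) (c + 1) (c + 2) (a - 1) a"
    using c unfolding feasible_def by simp
  with c show thesis
    by (intro that[of c]) simp_all
qed

text \<open>
  Let \<open>g y < -k\<close> and \<open>l < g z\<close> with \<open>y < z\<close>. As \<open>g\<close> decreases to the left of \<open>c\<close> and to the right of \<open>c2\<close>, the
  point \<open>y\<close> is not beyond \<open>c2\<close> and \<open>z\<close> is not before \<open>c\<close>, which bounds \<open>A\<close> from both sides. With \<open>A\<close> and
  \<open>B\<close> bounded, \<open>g\<close> is above \<open>-k\<close> far to the left and below \<open>l\<close> far to the right, uniformly. So moving \<open>d\<close>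
  and \<open>u\<close> into a fixed interval can only improve the two areas.
\<close>

lemma feasible_bounds:
  assumes c: "c \<le> a - 1"
  obtains A0 A1 d0 u0 where
    "\<And>A B d D U u. feasible A B d D U u \<Longrightarrow> B \<le> phi c \<Longrightarrow>
       A0 \<le> A \<and> A \<le> A1 \<and> feasible A B (max d d0) D U (min u u0)"
proof -
  have "0 < phi c"
    using c monotone_onD[OF phi_decreasing, of c a] phi_at_a by simp
  then obtain c2 where c2: "a < c2" "phi c2 = phi c"
    using phi_level[of c "phi c"] c by auto
  have ca: "c < a" using c by simp
  define A0 where "A0 = l + q c"
  define A1 where "A1 = - k - g 0 (phi c) c"
  obtain d0 where d0: "\<And>x. x \<le> d0 \<Longrightarrow> - k < g A0 (phi c) x"
    using g_unbounded_left[OF c, of "- k" A0] by blast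
  obtain u0 where u0: "\<And>x. u0 \<le> x \<Longrightarrow> A1 - l < q x"
    using q_unbounded_right[of "A1 - l"] by blast
  have "A0 \<le> A \<and> A \<le> A1 \<and> feasible A B (max d d0) D U (min u u0)"
    if feas: "feasible A B d D U u" and B: "B \<le> phi c" for A B d D U u
  proof -
    have o: "d \<le> D" "D \<le> U" "U \<le> u" and K: "lower_drop A B d D \<le> - K" and L: "L \<le> upper_rise A B U u"
      using feas unfolding feasible_def by simp_all
    have "0 < B" using feasible_B_pos[OF feas] .
    obtain y z where yz: "d < y" "y < D" "U < z" "z < u" "g A B y < - k" "l < g A B z"
      using feasible_crossing[OF feas] .
    have "y < z" "g A B y < g A B z"
      using yz o k_pos l_pos by linarith+
    note dec = g_decreasing_outside[OF ca c2(1) refl c2(2) B, of A]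
    have "y < c2"
      using monotone_onD[OF dec(2), of y z] \<open>y < z\<close> \<open>g A B y < g A B z\<close> by force
    have "c < z"
      using monotone_onD[OF dec(1), of y z] \<open>y < z\<close> \<open>g A B y < g A B z\<close> by force
    have upper: "g A B x \<le> A - q x" for x
      using \<open>0 < B\<close> by (simp add: g_eq)
    have lower: "A + g 0 (phi c) x \<le> g A B x" for x
      using mult_right_mono[OF B, of "decay x"] by (simp add: g_eq)
    note shape = g_piecewise[OF ca c2(1) refl c2(2), of 0]
    have "g 0 (phi c) c \<le> g 0 (phi c) y"
      using monotone_onD[OF shape(1), of y c] monotone_onD[OF shape(2), of c y] \<open>y < c2\<close>
      by (cases y c rule: linorder_cases) force+
    then have A1: "A \<le> A1"
      using yz lower[of y] unfolding A1_def by linarith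
    have A0: "A0 \<le> A"
      using yz upper[of z] q_mono[of c z] \<open>c < z\<close> unfolding A0_def by linarith
    have left: "- k < g A B x" if "x \<le> d0" for x
    proof -
      have "g A0 (phi c) x = A0 + g 0 (phi c) x"
        by (simp add: g_eq)
      then show ?thesis
        using d0[OF that] lower[of x] A0 by linarith
    qed
    have right: "g A B x < l" if "u0 \<le> x" for x
      using u0[OF that] upper[of x] A1 by linarith
    have "d0 < y" "z < u0"
      using left[of y] right[of z] yz by linarith+
    have "F A B d + k * d \<le> F A B (max d d0) + k * max d d0"
    proof (rule DERIV_nonneg_imp_increasing_open[where f = "\<lambda>x. F A B x + k * x"])
      fix x assume "d < x" "x < max d d0"
      then have "x \<le> d0" by auto
      then show "\<exists>y. ((\<lambda>x. F A B x + k * x) has_real_derivative y) (at x) \<and> 0 \<le> y"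
        using left[of x] by (intro exI[of _ "g A B x + k"] conjI F_plus_linear_deriv) simp
    qed (auto intro!: continuous_intros F_cont)
    then have "lower_drop A B (max d d0) D \<le> - K"
      using K unfolding lower_drop_def by linarith
    moreover have "F A B u + (- l) * u \<le> F A B (min u u0) + (- l) * min u u0"
    proof (rule DERIV_nonpos_imp_decreasing_open[where f = "\<lambda>x. F A B x + (- l) * x"])
      fix x assume "min u u0 < x" "x < u"
      then have "u0 \<le> x" by auto
      then show "\<exists>y. ((\<lambda>x. F A B x + (- l) * x) has_real_derivative y) (at x) \<and> y \<le> 0"
        using right[of x] by (intro exI[of _ "g A B x + (- l)"] conjI F_plus_linear_deriv) simp
    next
      show "continuous_on {min u u0..u} (\<lambda>x. F A B x + (- l) * x)"
        by (intro continuous_intros F_cont)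
    qed simp
    then have "L \<le> upper_rise A B U (min u u0)"
      using L unfolding upper_rise_def by linarith
    ultimately have "feasible A B (max d d0) D U (min u u0)"
      using o yz \<open>d0 < y\<close> \<open>z < u0\<close> unfolding feasible_def by simp
    with A0 A1 show ?thesis by blast
  qed
  then show thesis by (rule that)
qed

lemma minimal_feasible:
  obtains A B d D U u where "feasible A B d D U u" "0 < B" "\<exists>c<a. B \<le> phi c"
    "\<And>A' B' d' D' U' u'. feasible A' B' d' D' U' u' \<Longrightarrow> B' \<le> B \<Longrightarrow> B' = B"
proof -
  obtain A1 c d1 D1 U1 u1 where c: "c \<le> a - 1" and feas1: "feasible A1 (phi c) d1 D1 U1 u1"
    by (rule feasible_exists)
  obtain Al Au d0 u0 where bounds: "\<And>A B d D U u. feasible A B d D U u \<Longrightarrow> B \<le> phi c \<Longrightarrow>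
       Al \<le> A \<and> A \<le> Au \<and> feasible A B (max d d0) D U (min u u0)"
    using feasible_bounds[OF c] by blast
  define S where "S = ({Al..Au} \<times> {0..phi c} \<times> {d0..u0} \<times> {d0..u0} \<times> {d0..u0} \<times> {d0..u0})
    \<inter> {(A, B, d, D, U, u). feasible A B d D U u}"
  have clip: "(A, B, max d d0, D, U, min u u0) \<in> S" if "feasible A B d D U u" "B \<le> phi c" for A B d D U u
  proof -
    have "feasible A B (max d d0) D U (min u u0)" "Al \<le> A" "A \<le> Au"
      using bounds[OF that] by blast+
    moreover from this(1) have "max d d0 \<le> D" "D \<le> U" "U \<le> min u u0"
      by (simp_all only: feasible_def)
    ultimately show ?thesis
      unfolding S_def using that(2) feasible_B_pos[OF that(1)] by auto
  qed
  have cont_F: "continuous_on UNIV (\<lambda>p. F (f p) (f' p) (f'' p))"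
    if "continuous_on UNIV f" "continuous_on UNIV f'" "continuous_on UNIV f''"
    for f f' f'' :: "real \<times> real \<times> real \<times> real \<times> real \<times> real \<Rightarrow> real"
    unfolding F_def using lam_pos
    by (intro continuous_intros that continuous_on_compose2[OF Q_cont[of UNIV]]) auto
  have "closed {(A, B, d, D, U, u). feasible A B d D U u}"
    unfolding feasible_def lower_drop_def upper_rise_def case_prod_unfold
    by (intro closed_Collect_conj closed_Collect_le continuous_intros cont_F)
  then have "compact S"
    unfolding S_def by (intro compact_Int_closed compact_Times compact_Icc)
  moreover have "S \<noteq> {}"
    using clip[OF feas1] by auto
  ultimately have "\<exists>p\<in>S. \<forall>p'\<in>S. fst (snd p) \<le> fst (snd p')"
    by (intro continuous_attains_inf continuous_intros)
  then obtain A B d D U u where S: "(A, B, d, D, U, u) \<in> S"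
    and min: "\<And>p'. p' \<in> S \<Longrightarrow> B \<le> fst (snd p')"
    by (metis prod.collapse fst_conv snd_conv)
  have feas: "feasible A B d D U u" and B: "B \<le> phi c"
    using S unfolding S_def by auto
  show thesis
  proof (rule that[OF feas feasible_B_pos[OF feas]])
    show "\<exists>c<a. B \<le> phi c"
      using B c by (intro exI[of _ c]) simp
    show "B' = B" if "feasible A' B' d' D' U' u'" "B' \<le> B" for A' B' d' D' U' u'
      using min[OF clip[OF that(1)]] that(2) B by simp
  qed
qed

text \<open>
  Lowering \<open>B\<close> by \<open>e\<close> raises \<open>g\<close> by \<open>e * decay x\<close>, which helps the hump and harms the valley: this spends slack in
  the valley. If the slack is in the hump, lower \<open>A\<close> by \<open>e * decay d\<close> as well. Since \<open>decay\<close> decreases, \<open>g\<close> then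
  falls at every point to the right of \<open>d\<close>, so the valley gains and only the hump loses.
\<close>

lemma slack_lowers_B:
  assumes feas: "feasible A B d D U u"
    and slack: "lower_drop A B d D < - K \<or> L < upper_rise A B U u"
  shows "\<exists>A' B'. B' < B \<and> feasible A' B' d D U u"
proof -
  have o: "d \<le> D" "D \<le> U" "U \<le> u" and K: "lower_drop A B d D \<le> - K" and L: "L \<le> upper_rise A B U u"
    using feas unfolding feasible_def by simp_all
  have ex_mono: "decay y \<le> decay x" if "x \<le> y" for x y
    using that lam_pos by simp
  have drop: "lower_drop (A + b) (B + - e) d D = lower_drop A B d D + b * (D - d) + e / lam * (decay d - decay D)" for b e
    unfolding lower_drop_def F_shift by (simp add: algebra_simps diff_divide_distrib)
  have rise: "upper_rise (A + b) (B + - e) U u = upper_rise A B U u + b * (u - U) + e / lam * (decay U - decay u)" for b e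
    unfolding upper_rise_def F_shift by (simp add: algebra_simps diff_divide_distrib)
  from slack show ?thesis
  proof
    assume "lower_drop A B d D < - K"
    define t where "t = (decay d - decay D) / lam + 1"
    have t: "0 < t" "(decay d - decay D) / lam \<le> t"
      using ex_mono[OF o(1)] lam_pos unfolding t_def by (simp_all add: add_nonneg_pos)
    define e where "e = (- K - lower_drop A B d D) / t"
    have e: "0 < e" "e * t = - K - lower_drop A B d D"
      using t(1) \<open>lower_drop A B d D < - K\<close> by (simp_all add: e_def)
    have "e / lam * (decay d - decay D) \<le> e * t"
      using mult_left_mono[OF t(2), of e] e(1) by simp
    then have "lower_drop (A + 0) (B + - e) d D \<le> - K"
      using e(2) unfolding drop by linarith
    moreover have "0 \<le> e / lam * (decay U - decay u)"
      using e(1) lam_pos ex_mono[OF o(3)] by simp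
    then have "L \<le> upper_rise (A + 0) (B + - e) U u"
      using L unfolding rise by linarith
    ultimately have "feasible (A + 0) (B + - e) d D U u"
      using o unfolding feasible_def by blast
    with e(1) show ?thesis
      by (intro exI[of _ "A + 0"] exI[of _ "B + - e"] conjI) simp
  next
    assume "L < upper_rise A B U u"
    define t where "t = decay d * (u - U) + 1"
    have t: "0 < t" "decay d * (u - U) \<le> t"
      using o unfolding t_def by (simp_all add: add_nonneg_pos)
    define e where "e = (upper_rise A B U u - L) / t"
    have e: "0 < e" "e * t = upper_rise A B U u - L"
      using t(1) \<open>L < upper_rise A B U u\<close> by (simp_all add: e_def)
    have "e * (decay d * (u - U)) \<le> e * t"
      using mult_left_mono[OF t(2), of e] e(1) by simp
    moreover have "0 \<le> e / lam * (decay U - decay u)"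
      using e(1) lam_pos ex_mono[OF o(3)] by simp
    ultimately have "L \<le> upper_rise (A + - (e * decay d)) (B + - e) U u"
      using e(2) unfolding rise by (simp add: mult.assoc)
    moreover have "e / lam * (decay d - decay D) \<le> e * decay d * (D - d)"
    proof -
      have "decay D = decay d * exp (- lam * (D - d))"
        by (simp add: exp_add[symmetric] algebra_simps)
      moreover have "decay d * (1 + - lam * (D - d)) \<le> decay d * exp (- lam * (D - d))"
        by (intro mult_left_mono exp_ge_add_one_self) simp
      ultimately have "decay d - decay D \<le> lam * (decay d * (D - d))"
        by (simp add: algebra_simps)
      then have "e / lam * (decay d - decay D) \<le> e / lam * (lam * (decay d * (D - d)))"
        using e(1) lam_pos by (intro mult_left_mono) auto
      then show ?thesis
        using lam_pos by simp
    qed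
    then have "lower_drop (A + - (e * decay d)) (B + - e) d D \<le> - K"
      using K unfolding drop by simp
    ultimately have "feasible (A + - (e * decay d)) (B + - e) d D U u"
      using o unfolding feasible_def by blast
    with e(1) show ?thesis
      by (intro exI[of _ "A + - (e * decay d)"] exI[of _ "B + - e"] conjI) simp
  qed
qed

text \<open>
  Each endpoint, varied alone, extremises one of the two areas, so the derivative of that area with
  respect to it vanishes. For \<open>D\<close> and \<open>U\<close> this needs room on both sides, that is \<open>D < U\<close>. If \<open>D = U\<close>, then
  \<open>g\<close> is above \<open>-k\<close> or below \<open>l\<close> there; in the first case moving \<open>D\<close> to the left enlarges the area of the
  valley, in the second moving \<open>U\<close> to the right enlarges the area of the hump.
\<close>

lemma tight_endpoints:
  assumes feas: "feasible A B d D U u"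
    and tight: "\<And>d D U u. feasible A B d D U u \<Longrightarrow> lower_drop A B d D = - K \<and> upper_rise A B U u = L"
  shows "D < U" "g A B d = - k" "g A B D = - k" "g A B U = l" "g A B u = l"
proof -
  let ?W = "\<lambda>x. F A B x + k * x" and ?V = "\<lambda>x. - (F A B x + (- l) * x)"
  have W: "(?W has_real_derivative g A B x + k) (at x)"
    "((\<lambda>x. - ?W x) has_real_derivative - (g A B x + k)) (at x)" for x
    by (rule F_plus_linear_deriv DERIV_minus)+
  have V: "(?V has_real_derivative - (g A B x + (- l))) (at x)"
    "((\<lambda>x. - ?V x) has_real_derivative - (- (g A B x + (- l)))) (at x)" for x
    by (rule DERIV_minus F_plus_linear_deriv)+
  have o: "d \<le> D" "D \<le> U" "U \<le> u"
    and KL: "lower_drop A B d D = - K" "upper_rise A B U u = L"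
    using feas tight[OF feas] unfolding feasible_def by simp_all
  have "d \<noteq> D" "U \<noteq> u"
    using KL K_pos L_pos by (auto simp: lower_drop_def upper_rise_def)
  with o have o': "d < D" "U < u" by simp_all
  have no_better: "?W D' - ?W d' \<ge> - K" "?V u' - ?V U' \<ge> - L"
    if ord: "d' \<le> D'" "D' \<le> U'" "U' \<le> u'"
      and W': "?W D' - ?W d' \<le> - K" and V': "?V u' - ?V U' \<le> - L" for d' D' U' u'
  proof -
    have "feasible A B d' D' U' u'"
      using that unfolding feasible_def lower_drop_def upper_rise_def by simp
    from tight[OF this] show "?W D' - ?W d' \<ge> - K" "?V u' - ?V U' \<ge> - L"
      unfolding lower_drop_def upper_rise_def by simp_all
  qed
  have eqs: "?W D - ?W d = - K" "?V u - ?V U = - L"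
    using KL unfolding lower_drop_def upper_rise_def by simp_all
  have d_max: "?W x \<le> ?W d" if "x \<le> D" for x
    using no_better(1)[of x D U u] that o eqs by linarith
  have D_min: "?W D \<le> ?W x" if "d \<le> x" "x \<le> U" for x
    using no_better(1)[of d x U u] that o eqs by linarith
  have U_max: "?V x \<le> ?V U" if "D \<le> x" "x \<le> u" for x
    using no_better(2)[of d D x u] that o eqs by linarith
  have u_min: "?V u \<le> ?V x" if "U \<le> x" for x
    using no_better(2)[of d D U x] that o eqs by linarith
  show "g A B d = - k"
    using DERIV_local_max[OF W(1)[of d], of "D - d"] d_max o' by force
  show "g A B u = l"
    using DERIV_local_min[OF V(1)[of u], of "u - U"] u_min o' by force
  show "D < U"
  proof (rule ccontr)
    assume "\<not> D < U"
    with o have DU: "U = D" by simp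
    show False
    proof (cases "- k < g A B D")
      case True
      then obtain e where e: "0 < e" "\<And>h. 0 < h \<Longrightarrow> h < e \<Longrightarrow> ?W (D - h) < ?W D"
        using DERIV_pos_inc_left[OF W(1)[of D]] by auto
      define h where "h = min (e / 2) (D - d)"
      have "0 < h" "h < e" "h \<le> D - d"
        using e(1) o' by (auto simp: h_def)
      then show False
        using e(2)[of h] D_min[of "D - h"] o by simp
    next
      case False
      then have "0 < - (g A B U + (- l))"
        using DU k_pos l_pos by simp
      then obtain e where e: "0 < e" "\<And>h. 0 < h \<Longrightarrow> h < e \<Longrightarrow> ?V U < ?V (U + h)"
        using DERIV_pos_inc_right[OF V(1)[of U]] by auto
      define h where "h = min (e / 2) (u - U)"
      have "0 < h" "h < e" "h \<le> u - U"
        using e(1) o' by (auto simp: h_def)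
      then show False
        using e(2)[of h] U_max[of "U + h"] o by simp
    qed
  qed
  define e where "e = min (min (D - d) (U - D)) (u - U)"
  have e: "0 < e" "e \<le> D - d" "e \<le> U - D" "e \<le> u - U"
    using o' \<open>D < U\<close> by (auto simp: e_def)
  show "g A B D = - k"
    using DERIV_local_min[OF W(1)[of D] e(1)] D_min e by force
  show "g A B U = l"
    using DERIV_local_max[OF V(1)[of U] e(1)] U_max e by force
qed

lemma solution_exists:
  obtains A B x1 x2 d D U u where "solution A B x1 x2 d D U u"
proof -
  obtain A B d D U u where feas: "feasible A B d D U u" and "0 < B" and "\<exists>c<a. B \<le> phi c"
    and min: "\<And>A' B' d' D' U' u'. feasible A' B' d' D' U' u' \<Longrightarrow> B' \<le> B \<Longrightarrow> B' = B"
    using minimal_feasible by blast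
  then obtain x1 x2 where x: "x1 < a" "a < x2" "phi x1 = B" "phi x2 = B"
    using phi_level by metis
  have tight: "lower_drop A B d' D' = - K \<and> upper_rise A B U' u' = L"
    if feas': "feasible A B d' D' U' u'" for d' D' U' u'
  proof (rule ccontr)
    assume "\<not> ?thesis"
    then have "lower_drop A B d' D' < - K \<or> L < upper_rise A B U' u'"
      using feas' unfolding feasible_def by linarith
    then obtain A' B' where "B' < B" "feasible A' B' d' D' U' u'"
      using slack_lowers_B[OF feas'] by blast
    then show False
      using min[of A' B' d' D' U' u'] by simp
  qed
  note ends = tight_endpoints[OF feas tight]
  have KL: "lower_drop A B d D = - K" "upper_rise A B U u = L"
    using tight[OF feas] by simp_all
  then have "d \<noteq> D" "U \<noteq> u"
    using K_pos L_pos by (auto simp: lower_drop_def upper_rise_def)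
  then have "d < D" "U < u"
    using feas unfolding feasible_def by simp_all
  have dec1: "g A B y < g A B x" if "x < y" "y \<le> x1" for x y
    using monotone_onD[OF g_piecewise(1)[OF x], of x y] that by simp
  have inc: "g A B x < g A B y" if "x1 \<le> x" "x < y" "y \<le> x2" for x y
    using monotone_onD[OF g_piecewise(2)[OF x], of x y] that by simp
  have dec2: "g A B y < g A B x" if "x2 \<le> x" "x < y" for x y
    using monotone_onD[OF g_piecewise(3)[OF x], of x y] that by simp
  have "D < x2"
    using dec2[of D U] ends k_pos l_pos by linarith
  have "x1 < U"
    using dec1[of D U] ends k_pos l_pos by linarith
  have "d < x1"
    using inc[of d D] \<open>d < D\<close> \<open>D < x2\<close> ends by linarith
  moreover have "x1 < D"
    using dec1[of d D] \<open>d < D\<close> ends by linarith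
  moreover have "U < x2"
    using dec2[of U u] \<open>U < u\<close> ends by linarith
  moreover have "x2 < u"
    using inc[of U u] \<open>U < u\<close> \<open>x1 < U\<close> ends by linarith
  ultimately have "solution A B x1 x2 d D U u"
    using x KL ends unfolding solution_def by simp
  then show thesis by (rule that)
qed

lemma solution_iff:
  "(let g = g_fun mu lam a h A B in
      \<exists>x1 x2. turning_points g a x1 x2 \<and>
        d < x1 \<and> x1 < D \<and> D < U \<and> U < x2 \<and> x2 < u \<and>
        (LBINT x=d..D. g x + k) = - K \<and>
        (LBINT x=U..u. g x - l) = L \<and>
        g d = - k \<and> g D = - k \<and> g U = l \<and> g u = l)
   \<longleftrightarrow> (\<exists>x1 x2. solution A B x1 x2 d D U u)"
proof -
  have "(LBINT x=U..u. g A B x - l) = upper_rise A B U u"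
    using area_eq[of U u A B "- l"] unfolding upper_rise_def by simp
  then show ?thesis
    unfolding Let_def solution_def turning_points_iff area_eq lower_drop_def[symmetric]
    by (simp only: conj_assoc)
qed

end

theorem theorem5p2:
  fixes mu sigma K L k l a lam :: real and h :: "real \<Rightarrow> real"
  assumes "mu > 0" and "sigma > 0" and "K > 0" and "L > 0" and "k > 0" and "l > 0"
    and "lam = 2 * mu / sigma\<^sup>2"
    and "holding_cost lam a h"
  shows "\<exists>!(A, B, d, D, U, u).
    (let g = g_fun mu lam a h A B in
      \<exists>x1 x2. turning_points g a x1 x2 \<and>
        d < x1 \<and> x1 < D \<and> D < U \<and> U < x2 \<and> x2 < u \<and>
        (LBINT x=d..D. g x + k) = - K \<and>
        (LBINT x=U..u. g x - l) = L \<and>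
        g d = - k \<and> g D = - k \<and> g U = l \<and> g u = l)"
proof -
  interpret convex_cost_control mu lam a h K L k l
    using assms by unfold_locales simp_all
  obtain A B x1 x2 d D U u where sol: "solution A B x1 x2 d D U u"
    by (rule solution_exists)
  have "\<exists>!(A, B, d, D, U, u). \<exists>x1 x2. solution A B x1 x2 d D U u"
  proof (rule ex1I[of _ "(A, B, d, D, U, u)"])
    show "case (A, B, d, D, U, u) of (A, B, d, D, U, u) \<Rightarrow> \<exists>x1 x2. solution A B x1 x2 d D U u"
      using sol by auto
    fix p assume p: "case p of (A, B, d, D, U, u) \<Rightarrow> \<exists>x1 x2. solution A B x1 x2 d D U u"
    obtain A' B' d' D' U' u' where p_eq: "p = (A', B', d', D', U', u')"
      by (cases p) auto
    with p obtain x1' x2' where "solution A' B' x1' x2' d' D' U' u'"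
      by auto
    from solution_unique[OF sol this] show "p = (A, B, d, D, U, u)"
      by (simp add: p_eq)
  qed
  then show ?thesis
    unfolding solution_iff .
qed

end
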